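(* Let $G$ be a countably infinite group acting continuously on a compact space $X$. Let $\mu$ be a probability measure on $G$ such that $S:=\operatorname{supp}(\mu)$ generates $G$. Assume that $\mu$ is evenly distributed and that the action of $G$ on $X$ converges in word metric with respect to $S$ to a space average with respect to a measure $\nu$ on $X$. Then $\nu$ is $\mu$-stationary, i.e. $\mu*\nu=\nu$.
   Context: Compact spaces are Hausdorff and measures on them are regular Borel, so that the Riesz representation theorem applies. "$S$ generates $G$" means every element of $G$ is a finite product of elements of $S$, so that the word metric is defined: $\|e\|_S=0$ and $\|g\|_S=\min\{n:g=s_1\cdots s_n,\ s_i\in S\}$ for $g\neq e$. Set $G_n=\{g\in G:\|g\|_S=n\}$. $\mu^{*n}$ is the $n$-th convolution power of $\mu$ on $G$, and $\int_X f\,d(\mu*\pi)=\int_G\int_X f(gx)\,d\pi(x)\,d\mu(g)$. $\mu$ is evenly distributed if the mass $\mu^{*n}$ assigns to an element depends only on its word length: for all $n,m\in\mathbb{N}$ there is $\mu_{n,m}\in[0,1]$ such that $\mu^{*n}(g)=\mu_{n,m}$ for every $g\in G$ with $\|g\|_S=m$ (here $m=0$ is allowed). The action converges in word metric with respect to $S$ if for every $f\in C(X)$ and $x\in X$ the limit $\lim_{n\to\infty}\frac1{|G_n|}\sum_{g\in G_n}f(gx)$ exists; it converges to a space average with respect to $\nu$ if this limit equals $\int_X f\,d\nu$ for every $f\in C(X)$ and $x\in X$. *)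

theory Defs
  imports "HOL-Probability.Probability" "HOL-Algebra.Group_Action"
begin

section \<open>Word length with respect to a set of monoid generators\<close>

definition word_product :: "('g, 'b) monoid_scheme \<Rightarrow> 'g list \<Rightarrow> 'g" where
  "word_product G ss = foldr (\<lambda>s g. s \<otimes>\<^bsub>G\<^esub> g) ss \<one>\<^bsub>G\<^esub>"

text \<open>Inverses of elements of \<open>S\<close> are not allowed as letters, unlike in the library's \<open>generate\<close>.\<close>

definition generates :: "('g, 'b) monoid_scheme \<Rightarrow> 'g set \<Rightarrow> bool" where
  "generates G S \<longleftrightarrow>
     S \<subseteq> carrier G \<and> (\<forall>g\<in>carrier G. \<exists>ss. set ss \<subseteq> S \<and> word_product G ss = g)"

definition word_length :: "('g, 'b) monoid_scheme \<Rightarrow> 'g set \<Rightarrow> 'g \<Rightarrow> nat" where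
  "word_length G S g =
     (if g = \<one>\<^bsub>G\<^esub> then 0
      else LEAST n. \<exists>ss. length ss = n \<and> set ss \<subseteq> S \<and> word_product G ss = g)"

definition word_sphere :: "('g, 'b) monoid_scheme \<Rightarrow> 'g set \<Rightarrow> nat \<Rightarrow> 'g set" where
  "word_sphere G S n = {g \<in> carrier G. word_length G S g = n}"


section \<open>Probability measures on a discrete group\<close>

text \<open>
  A probability measure on a countable group \<open>G\<close> is a \<open>pmf\<close> whose support \<open>set_pmf\<close> lies in
  \<open>carrier G\<close>.
\<close>

definition conv_pmf :: "('g, 'b) monoid_scheme \<Rightarrow> 'g pmf \<Rightarrow> 'g pmf \<Rightarrow> 'g pmf" where
  "conv_pmf G \<mu> \<kappa> = map_pmf (\<lambda>(g, h). g \<otimes>\<^bsub>G\<^esub> h) (pair_pmf \<mu> \<kappa>)"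

primrec conv_power :: "('g, 'b) monoid_scheme \<Rightarrow> 'g pmf \<Rightarrow> nat \<Rightarrow> 'g pmf" where
  "conv_power G \<mu> 0 = return_pmf \<one>\<^bsub>G\<^esub>"
| "conv_power G \<mu> (Suc n) = conv_pmf G \<mu> (conv_power G \<mu> n)"

definition evenly_distributed :: "('g, 'b) monoid_scheme \<Rightarrow> 'g pmf \<Rightarrow> bool" where
  "evenly_distributed G \<mu> \<longleftrightarrow>
     (\<forall>n m. \<exists>c::real. 0 \<le> c \<and> c \<le> 1 \<and>
        (\<forall>g\<in>carrier G. word_length G (set_pmf \<mu>) g = m \<longrightarrow> pmf (conv_power G \<mu> n) g = c))"


section \<open>Continuous actions, measures and averages\<close>

text \<open>\<open>G\<close> is discrete, so joint continuity of the action is continuity of each \<open>\<phi> g\<close>.\<close>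

definition continuous_action ::
    "('g, 'b) monoid_scheme \<Rightarrow> ('g \<Rightarrow> 'x \<Rightarrow> 'x::topological_space) \<Rightarrow> bool" where
  "continuous_action G \<phi> \<longleftrightarrow>
     group_action G UNIV \<phi> \<and> (\<forall>g\<in>carrier G. continuous_on UNIV (\<phi> g))"

definition regular_borel_measure :: "'x::topological_space measure \<Rightarrow> bool" where
  "regular_borel_measure \<nu> \<longleftrightarrow>
     sets \<nu> = sets borel \<and> finite_measure \<nu> \<and>
     (\<forall>A\<in>sets borel.
        emeasure \<nu> A = (INF U\<in>{U. open U \<and> A \<subseteq> U}. emeasure \<nu> U) \<and>
        emeasure \<nu> A = (SUP K\<in>{K. compact K \<and> K \<subseteq> A}. emeasure \<nu> K))"

text \<open>
  The convolution \<open>\<mu> * \<pi>\<close> is the mixture of the translates of \<open>\<pi>\<close>,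
  \<open>(\<mu> * \<pi>)(A) = \<integral> \<pi>(g\<^sup>-\<^sup>1 A) d\<mu>(g)\<close>.  Lemma \<open>integral_action_conv\<close> below gives the defining formula
  \<open>\<integral> f d(\<mu> * \<pi>) = \<integral> \<integral> f(g x) d\<pi>(x) d\<mu>(g)\<close>.
\<close>

definition action_conv ::
    "('g \<Rightarrow> 'x \<Rightarrow> 'x) \<Rightarrow> 'g pmf \<Rightarrow> 'x::topological_space measure \<Rightarrow> 'x measure" where
  "action_conv \<phi> \<mu> \<pi> =
     measure_of UNIV (sets borel) (\<lambda>A. \<integral>\<^sup>+ g. emeasure \<pi> (\<phi> g -` A) \<partial>measure_pmf \<mu>)"

definition stationary ::
    "('g \<Rightarrow> 'x \<Rightarrow> 'x) \<Rightarrow> 'g pmf \<Rightarrow> 'x::topological_space measure \<Rightarrow> bool" where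
  "stationary \<phi> \<mu> \<nu> \<longleftrightarrow> action_conv \<phi> \<mu> \<nu> = \<nu>"

text \<open>
  If \<open>S\<close> is the support of an evenly distributed measure, \<open>S\<close> is finite, since that measure is
  constant on \<open>S - {\<one>}\<close>.  If moreover \<open>S\<close> generates the infinite group \<open>G\<close>, all spheres are finite
  and nonempty, so the degenerate values of \<open>card\<close>, \<open>sum\<close> and division do not occur.
\<close>

definition sphere_average ::
    "('g, 'b) monoid_scheme \<Rightarrow> 'g set \<Rightarrow> ('g \<Rightarrow> 'x \<Rightarrow> 'x) \<Rightarrow> nat \<Rightarrow> ('x \<Rightarrow> real) \<Rightarrow> 'x \<Rightarrow> real" where
  "sphere_average G S \<phi> n f x =
     1 / real (card (word_sphere G S n)) * (\<Sum>g\<in>word_sphere G S n. f (\<phi> g x))"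

definition converges_to_space_average ::
    "('g, 'b) monoid_scheme \<Rightarrow> 'g set \<Rightarrow> ('g \<Rightarrow> 'x \<Rightarrow> 'x) \<Rightarrow> 'x::topological_space measure \<Rightarrow> bool"
  where
  "converges_to_space_average G S \<phi> \<nu> \<longleftrightarrow>
     (\<forall>f x. continuous_on UNIV f \<longrightarrow>
        (\<lambda>n. sphere_average G S \<phi> n f x) \<longlonglongrightarrow> (LINT y|\<nu>. f y))"


section \<open>Integration against the convolution\<close>

lemma sets_action_conv [simp, measurable_cong]: "sets (action_conv \<phi> \<mu> \<pi>) = sets borel"
  unfolding action_conv_def
  using sets.sigma_sets_eq[of borel, unfolded space_borel] by (simp add: sets_measure_of)

lemma space_action_conv [simp]: "space (action_conv \<phi> \<mu> \<pi>) = UNIV"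
  unfolding action_conv_def by (simp add: space_measure_of_conv)

context
  fixes \<phi> :: "'g \<Rightarrow> 'x \<Rightarrow> 'x::topological_space" and \<mu> :: "'g pmf" and \<pi> :: "'x measure"
  assumes meas: "\<And>g. g \<in> set_pmf \<mu> \<Longrightarrow> \<phi> g \<in> borel_measurable borel"
    and sets_pi: "sets \<pi> = sets borel"
begin

lemma emeasure_action_conv:
  assumes A: "A \<in> sets borel"
  shows "emeasure (action_conv \<phi> \<mu> \<pi>) A = (\<integral>\<^sup>+ g. emeasure \<pi> (\<phi> g -` A) \<partial>measure_pmf \<mu>)"
proof (rule emeasure_measure_of[OF action_conv_def])
  show "sets borel \<subseteq> Pow UNIV" by simp
  show "A \<in> sets (action_conv \<phi> \<mu> \<pi>)" using A by simp
  show "positive (sets (action_conv \<phi> \<mu> \<pi>))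
      (\<lambda>A. \<integral>\<^sup>+ g. emeasure \<pi> (\<phi> g -` A) \<partial>measure_pmf \<mu>)"
    by (simp add: positive_def)
  show "countably_additive (sets (action_conv \<phi> \<mu> \<pi>))
      (\<lambda>A. \<integral>\<^sup>+ g. emeasure \<pi> (\<phi> g -` A) \<partial>measure_pmf \<mu>)"
  proof (rule countably_additiveI)
    fix B :: "nat \<Rightarrow> 'x set"
    assume B: "range B \<subseteq> sets (action_conv \<phi> \<mu> \<pi>)" "disjoint_family B"
    have "(\<Sum>i. \<integral>\<^sup>+ g. emeasure \<pi> (\<phi> g -` B i) \<partial>measure_pmf \<mu>) =
        (\<integral>\<^sup>+ g. (\<Sum>i. emeasure \<pi> (\<phi> g -` B i)) \<partial>measure_pmf \<mu>)"
      by (rule nn_integral_suminf[symmetric]) simp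
    also have "\<dots> = (\<integral>\<^sup>+ g. emeasure \<pi> (\<phi> g -` (\<Union>i. B i)) \<partial>measure_pmf \<mu>)"
    proof (rule nn_integral_cong_AE, unfold AE_measure_pmf_iff, rule ballI)
      fix g assume g: "g \<in> set_pmf \<mu>"
      have "range (\<lambda>i. \<phi> g -` B i) \<subseteq> sets \<pi>"
        using B(1) measurable_sets[OF meas[OF g]] by (auto simp: sets_pi)
      moreover have "disjoint_family (\<lambda>i. \<phi> g -` B i)"
        using B(2) by (auto simp: disjoint_family_on_def)
      ultimately show "(\<Sum>i. emeasure \<pi> (\<phi> g -` B i)) = emeasure \<pi> (\<phi> g -` (\<Union>i. B i))"
        by (simp add: suminf_emeasure vimage_UN)
    qed
    finally show "(\<Sum>i. \<integral>\<^sup>+ g. emeasure \<pi> (\<phi> g -` B i) \<partial>measure_pmf \<mu>) =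
        (\<integral>\<^sup>+ g. emeasure \<pi> (\<phi> g -` (\<Union>i. B i)) \<partial>measure_pmf \<mu>)" .
  qed
qed

lemma nn_integral_action_conv:
  assumes f: "f \<in> borel_measurable borel"
  shows "(\<integral>\<^sup>+ x. f x \<partial>action_conv \<phi> \<mu> \<pi>) = (\<integral>\<^sup>+ g. \<integral>\<^sup>+ x. f (\<phi> g x) \<partial>\<pi> \<partial>measure_pmf \<mu>)"
  using f
proof (induction rule: borel_measurable_induct)
  case (cong f g)
  then show ?case by (simp add: space_borel)
next
  case (set A)
  have "(\<integral>\<^sup>+ g. \<integral>\<^sup>+ x. indicator A (\<phi> g x) \<partial>\<pi> \<partial>measure_pmf \<mu>) =
      (\<integral>\<^sup>+ g. emeasure \<pi> (\<phi> g -` A) \<partial>measure_pmf \<mu>)"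
  proof (rule nn_integral_cong_AE, unfold AE_measure_pmf_iff, rule ballI)
    fix g assume g: "g \<in> set_pmf \<mu>"
    have "\<phi> g -` A \<in> sets \<pi>"
      using measurable_sets[OF meas[OF g] set] by (simp add: sets_pi)
    moreover have "(\<lambda>x. indicator A (\<phi> g x) :: ennreal) = indicator (\<phi> g -` A)"
      by (auto simp: fun_eq_iff indicator_def)
    ultimately show "(\<integral>\<^sup>+ x. indicator A (\<phi> g x) \<partial>\<pi>) = emeasure \<pi> (\<phi> g -` A)"
      by simp
  qed
  then show ?case using set by (simp add: emeasure_action_conv)
next
  case (mult u c)
  have "(\<integral>\<^sup>+ x. c * u (\<phi> g x) \<partial>\<pi>) = c * (\<integral>\<^sup>+ x. u (\<phi> g x) \<partial>\<pi>)" if "g \<in> set_pmf \<mu>" for g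
    using measurable_compose[OF meas[OF that] mult(2)]
    by (intro nn_integral_cmult) (simp add: measurable_cong_sets[OF sets_pi refl])
  then have "(\<integral>\<^sup>+ g. \<integral>\<^sup>+ x. c * u (\<phi> g x) \<partial>\<pi> \<partial>measure_pmf \<mu>) =
      (\<integral>\<^sup>+ g. c * \<integral>\<^sup>+ x. u (\<phi> g x) \<partial>\<pi> \<partial>measure_pmf \<mu>)"
    by (intro nn_integral_cong_AE) (simp add: AE_measure_pmf_iff)
  moreover have "u \<in> borel_measurable (action_conv \<phi> \<mu> \<pi>)"
    using mult(2) by (simp add: measurable_cong_sets[OF sets_action_conv refl])
  ultimately show ?case using mult by (simp add: nn_integral_cmult)
next
  case (add u v)
  have uv: "u \<in> borel_measurable borel" "v \<in> borel_measurable borel"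
    using add by simp_all
  have "(\<integral>\<^sup>+ x. v (\<phi> g x) + u (\<phi> g x) \<partial>\<pi>) =
      (\<integral>\<^sup>+ x. v (\<phi> g x) \<partial>\<pi>) + (\<integral>\<^sup>+ x. u (\<phi> g x) \<partial>\<pi>)" if "g \<in> set_pmf \<mu>" for g
    using measurable_compose[OF meas[OF that] uv(1)] measurable_compose[OF meas[OF that] uv(2)]
    by (intro nn_integral_add) (simp_all add: measurable_cong_sets[OF sets_pi refl])
  then have "(\<integral>\<^sup>+ g. \<integral>\<^sup>+ x. v (\<phi> g x) + u (\<phi> g x) \<partial>\<pi> \<partial>measure_pmf \<mu>) =
      (\<integral>\<^sup>+ g. (\<integral>\<^sup>+ x. v (\<phi> g x) \<partial>\<pi>) + (\<integral>\<^sup>+ x. u (\<phi> g x) \<partial>\<pi>) \<partial>measure_pmf \<mu>)"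
    by (intro nn_integral_cong_AE) (simp add: AE_measure_pmf_iff)
  moreover have "u \<in> borel_measurable (action_conv \<phi> \<mu> \<pi>)" "v \<in> borel_measurable (action_conv \<phi> \<mu> \<pi>)"
    using add by (simp_all add: measurable_cong_sets[OF sets_action_conv refl])
  ultimately show ?case using add by (simp add: nn_integral_add)
next
  case (seq U)
  have U: "U i \<in> borel_measurable (action_conv \<phi> \<mu> \<pi>)" for i
    using seq by (simp add: measurable_cong_sets[OF sets_action_conv refl])
  have "(\<integral>\<^sup>+ x. (SUP i. U i (\<phi> g x)) \<partial>\<pi>) = (SUP i. \<integral>\<^sup>+ x. U i (\<phi> g x) \<partial>\<pi>)"
    if "g \<in> set_pmf \<mu>" for g
    using measurable_compose[OF meas[OF that] seq(1)] seq
    by (intro nn_integral_monotone_convergence_SUP)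
      (auto simp: measurable_cong_sets[OF sets_pi refl] incseq_def le_fun_def)
  then have "(\<integral>\<^sup>+ g. \<integral>\<^sup>+ x. (SUP i. U i (\<phi> g x)) \<partial>\<pi> \<partial>measure_pmf \<mu>) =
      (\<integral>\<^sup>+ g. (SUP i. \<integral>\<^sup>+ x. U i (\<phi> g x) \<partial>\<pi>) \<partial>measure_pmf \<mu>)"
    by (intro nn_integral_cong_AE) (simp add: AE_measure_pmf_iff)
  also have "\<dots> = (SUP i. \<integral>\<^sup>+ g. \<integral>\<^sup>+ x. U i (\<phi> g x) \<partial>\<pi> \<partial>measure_pmf \<mu>)"
    using seq by (intro nn_integral_monotone_convergence_SUP)
      (auto simp: incseq_def le_fun_def intro!: nn_integral_mono)
  also have "\<dots> = (SUP i. \<integral>\<^sup>+ x. U i x \<partial>action_conv \<phi> \<mu> \<pi>)"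
    using seq by simp
  also have "\<dots> = (\<integral>\<^sup>+ x. (SUP i. U i x) \<partial>action_conv \<phi> \<mu> \<pi>)"
    using seq U by (intro nn_integral_monotone_convergence_SUP[symmetric]) auto
  finally show ?case by (simp add: image_comp)
qed

lemma emeasure_action_conv_UNIV: "emeasure (action_conv \<phi> \<mu> \<pi>) UNIV = emeasure \<pi> UNIV"
  by (simp add: emeasure_action_conv)

lemma integral_action_conv:
  fixes f :: "'x \<Rightarrow> real"
  assumes fin: "finite_measure \<pi>" and f: "f \<in> borel_measurable borel" and bdd: "bounded (range f)"
  shows "(LINT x|action_conv \<phi> \<mu> \<pi>. f x) = (LINT g|measure_pmf \<mu>. LINT x|\<pi>. f (\<phi> g x))"
proof -
  interpret finite_measure \<pi> by fact
  have sp: "space \<pi> = UNIV" using sets_eq_imp_space_eq[OF sets_pi] by simp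
  interpret C: finite_measure "action_conv \<phi> \<mu> \<pi>"
    by (rule finite_measureI)
      (use emeasure_finite[of "space \<pi>"] in \<open>simp add: emeasure_action_conv_UNIV sp\<close>)
  have tot: "measure (action_conv \<phi> \<mu> \<pi>) UNIV = measure \<pi> UNIV"
    by (simp add: measure_def emeasure_action_conv_UNIV)
  obtain c where c: "\<And>x. \<bar>f x\<bar> \<le> c"
    using bdd by (auto simp: bounded_iff)
  have c0: "0 \<le> c" using c[of undefined] by linarith
  define h where "h x = f x + c" for x
  have h0: "0 \<le> h x" and hc: "h x \<le> 2 * c" for x
    using c[of x] by (auto simp: h_def)
  have h_meas: "h \<in> borel_measurable borel" unfolding h_def using f by measurable
  have fC: "integrable (action_conv \<phi> \<mu> \<pi>) f"
    using c f by (intro C.integrable_const_bound[where B = c])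
      (auto simp: measurable_cong_sets[OF sets_action_conv refl])
  have fg_meas: "(\<lambda>x. f (\<phi> g x)) \<in> borel_measurable \<pi>"
    and hg_meas: "(\<lambda>x. h (\<phi> g x)) \<in> borel_measurable \<pi>" if "g \<in> set_pmf \<mu>" for g
    using measurable_compose[OF meas[OF that] f] measurable_compose[OF meas[OF that] h_meas]
    by (simp_all add: measurable_cong_sets[OF sets_pi refl])
  have fg: "integrable \<pi> (\<lambda>x. f (\<phi> g x))" if "g \<in> set_pmf \<mu>" for g
    using c fg_meas[OF that] by (intro integrable_const_bound[where B = c]) auto
  have hg: "integrable \<pi> (\<lambda>x. h (\<phi> g x))" if "g \<in> set_pmf \<mu>" for g
    using fg[OF that] unfolding h_def by simp
  have I: "(LINT x|\<pi>. h (\<phi> g x)) = (LINT x|\<pi>. f (\<phi> g x)) + c * measure \<pi> UNIV"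
    if "g \<in> set_pmf \<mu>" for g
    unfolding h_def using fg[OF that] by (simp add: sp)
  have bound: "norm (LINT x|\<pi>. f (\<phi> g x)) \<le> c * measure \<pi> UNIV" if "g \<in> set_pmf \<mu>" for g
  proof -
    have "norm (LINT x|\<pi>. f (\<phi> g x)) \<le> (LINT x|\<pi>. norm (f (\<phi> g x)))" by simp
    also have "\<dots> \<le> (LINT x|\<pi>. c)"
      using fg[OF that] c by (intro integral_mono) auto
    finally show ?thesis by (simp add: sp mult.commute)
  qed
  have int: "integrable (measure_pmf \<mu>) (\<lambda>g. LINT x|\<pi>. f (\<phi> g x))"
    using bound by (intro measure_pmf.integrable_const_bound[where B = "c * measure \<pi> UNIV"])
      (simp_all add: AE_measure_pmf_iff)
  have int': "integrable (measure_pmf \<mu>) (\<lambda>g. LINT x|\<pi>. h (\<phi> g x))"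
    using int I by (subst integrable_cong_AE[where g = "\<lambda>g. (LINT x|\<pi>. f (\<phi> g x)) + c * measure \<pi> UNIV"])
      (auto simp: AE_measure_pmf_iff)
  have "(LINT x|action_conv \<phi> \<mu> \<pi>. f x) + c * measure \<pi> UNIV = (LINT x|action_conv \<phi> \<mu> \<pi>. h x)"
    unfolding h_def using fC by (simp add: tot)
  also have "\<dots> = enn2real (\<integral>\<^sup>+ x. ennreal (h x) \<partial>action_conv \<phi> \<mu> \<pi>)"
    using h0 h_meas by (intro integral_eq_nn_integral)
      (auto simp: measurable_cong_sets[OF sets_action_conv refl])
  also have "(\<integral>\<^sup>+ x. ennreal (h x) \<partial>action_conv \<phi> \<mu> \<pi>) =
      (\<integral>\<^sup>+ g. \<integral>\<^sup>+ x. ennreal (h (\<phi> g x)) \<partial>\<pi> \<partial>measure_pmf \<mu>)"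
    using h_meas by (intro nn_integral_action_conv) measurable
  also have "\<dots> = (\<integral>\<^sup>+ g. ennreal (LINT x|\<pi>. h (\<phi> g x)) \<partial>measure_pmf \<mu>)"
    using hg h0 by (intro nn_integral_cong_AE)
      (auto simp: AE_measure_pmf_iff intro!: nn_integral_eq_integral)
  also have "\<dots> = ennreal (LINT g|measure_pmf \<mu>. LINT x|\<pi>. h (\<phi> g x))"
    using int' h0 by (intro nn_integral_eq_integral) auto
  also have "enn2real \<dots> = (LINT g|measure_pmf \<mu>. LINT x|\<pi>. h (\<phi> g x))"
    using h0 by (intro enn2real_ennreal integral_nonneg_AE AE_I2) simp
  also have "\<dots> = (LINT g|measure_pmf \<mu>. (LINT x|\<pi>. f (\<phi> g x)) + c * measure \<pi> UNIV)"
    using I by (intro integral_cong_AE) (auto simp: AE_measure_pmf_iff)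
  also have "\<dots> = (LINT g|measure_pmf \<mu>. LINT x|\<pi>. f (\<phi> g x)) + c * measure \<pi> UNIV"
    using int by simp
  finally show ?thesis by simp
qed

end

end

theory Submission
  imports Defs
begin

text \<open>
  Write \<open>P f(y) = \<integral> f(s y) d\<mu>(s)\<close>.  Stationarity of \<open>\<nu>\<close> says \<open>\<integral> P f d\<nu> = \<integral> f d\<nu>\<close> for all continuous \<open>f\<close>,
  up to the uniqueness of the representing measure.  Fix a point \<open>x\<close> and put
  \<open>E n f = \<integral> f(g x) d\<mu>\<^sup>n(g)\<close> with \<open>\<mu>\<^sup>n\<close> the convolution power, so that \<open>E (n + 1) f = E n (P f)\<close>.
  The Cesaro means of \<open>E n f\<close> and of \<open>E n (P f)\<close> then differ by a telescoping sum divided by \<open>N\<close>,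
  hence have the same limit.  The point is that the limit is the space average.

  An evenly distributed \<open>\<mu>\<^sup>n\<close> is a convex combination of the uniform measures on the
  spheres, so \<open>E n f\<close> is the same combination of sphere averages of \<open>f\<close> (\<open>expectation_radial\<close>).
  The sphere averages tend to \<open>\<integral> f d\<nu>\<close>, so it suffices that the weight of every fixed sphere tends
  to zero in the Cesaro sense, which follows from the infinity of \<open>G\<close>
  (\<open>expected_visits_sublinear\<close>).  Let \<open>u\<^sub>N(g)\<close> be the expected number of visits to \<open>g\<close> before time \<open>N\<close>.
  Conditioning on the factor applied last shows that \<open>u\<^sub>N(g)\<close> exceeds the \<open>\<mu>\<close>-average of the
  \<open>u\<^sub>N(s\<^sup>-\<^sup>1 g)\<close> by at most \<open>1\<close>.  So if \<open>g\<close> nearly maximizes \<open>u\<^sub>N\<close>, then so does \<open>s\<^sup>-\<^sup>1 g\<close> for each \<open>s\<close>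
  in the support, with a loss independent of \<open>N\<close>.  As the support generates \<open>G\<close>, any prescribed
  number \<open>k\<close> of points have \<open>u\<^sub>N\<close> within a constant of the maximum; the total of \<open>u\<^sub>N\<close> being \<open>N\<close>,
  the maximum is at most \<open>N / k + O(1)\<close>.

  The support of \<open>\<mu>\<close> is finite, because \<open>\<mu>\<close> is constant on its non-identity part.  Hence spheres are
  finite, \<open>P\<close> preserves continuity, and \<open>\<mu> * \<nu>\<close>, a finite mixture of homeomorphic images of \<open>\<nu>\<close>,
  inherits inner regularity from \<open>\<nu>\<close>.
\<close>

section \<open>Word length and convolution powers\<close>

lemma pmf_weighted_le_integral:
  fixes F :: "'a \<Rightarrow> real"
  assumes "s \<in> set_pmf p" and nonneg: "\<And>x. x \<in> set_pmf p \<Longrightarrow> 0 \<le> F x"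
    and le: "\<And>x. x \<in> set_pmf p \<Longrightarrow> F x \<le> B"
  shows "pmf p s * F s \<le> (LINT x|measure_pmf p. F x)"
proof -
  have int: "integrable (measure_pmf p) F"
    using nonneg le by (intro measure_pmf.integrable_const_bound[where B = B])
      (auto simp: AE_measure_pmf_iff)
  have "pmf p s * F s = (LINT x|measure_pmf p. indicator {s} x * F s)"
    by (simp add: pmf.rep_eq)
  also have "\<dots> = (LINT x|measure_pmf p. indicator {s} x * F x)"
    by (intro Bochner_Integration.integral_cong) (auto simp: indicator_def)
  also have "\<dots> \<le> (LINT x|measure_pmf p. F x)"
  proof (rule integral_mono_AE)
    show "integrable (measure_pmf p) (\<lambda>x. indicator {s} x * F x)"
      using nonneg le \<open>s \<in> set_pmf p\<close>
      by (intro measure_pmf.integrable_const_bound[where B = B])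
        (auto simp: AE_measure_pmf_iff indicator_def intro: order_trans)
  qed (use int nonneg in \<open>auto simp: AE_measure_pmf_iff indicator_def\<close>)
  finally show ?thesis .
qed

context group
begin

lemma word_product_Nil [simp]: "word_product G [] = \<one>"
  and word_product_Cons [simp]: "word_product G (s # ss) = s \<otimes> word_product G ss"
  by (simp_all add: word_product_def)

lemma word_product_closed: "set ss \<subseteq> carrier G \<Longrightarrow> word_product G ss \<in> carrier G"
  by (induction ss) auto

lemma word_length_le:
  assumes "set ss \<subseteq> S"
  shows "word_length G S (word_product G ss) \<le> length ss"
  using assms by (auto simp: word_length_def intro!: Least_le)

lemma word_of_minimal_length:
  assumes "generates G S" "g \<in> carrier G"
  obtains ss where "set ss \<subseteq> S" "word_product G ss = g" "length ss = word_length G S g"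
proof (cases "g = \<one>")
  case True
  then show ?thesis using that[of "[]"] by (simp add: word_length_def)
next
  case False
  have "\<exists>n ss. length ss = n \<and> set ss \<subseteq> S \<and> word_product G ss = g"
    using assms by (auto simp: generates_def)
  from LeastI_ex[OF this] show ?thesis
    using that False by (auto simp: word_length_def)
qed

lemma word_length_generator:
  assumes "s \<in> S" "s \<in> carrier G" "s \<noteq> \<one>"
  shows "word_length G S s = 1"
  unfolding word_length_def
proof (simp only: assms(3) if_False, rule Least_equality)
  show "\<exists>ss. length ss = 1 \<and> set ss \<subseteq> S \<and> word_product G ss = s"
    using assms by (intro exI[of _ "[s]"]) simp
next
  fix n assume "\<exists>ss. length ss = n \<and> set ss \<subseteq> S \<and> word_product G ss = s"
  then show "1 \<le> n" using assms(3) by (cases n) auto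
qed

lemma finite_word_ball:
  assumes "generates G S" "finite S"
  shows "finite {g \<in> carrier G. word_length G S g \<le> n}"
proof (rule finite_subset)
  show "{g \<in> carrier G. word_length G S g \<le> n} \<subseteq>
      word_product G ` {ss. set ss \<subseteq> S \<and> length ss \<le> n}"
  proof
    fix g assume "g \<in> {g \<in> carrier G. word_length G S g \<le> n}"
    then show "g \<in> word_product G ` {ss. set ss \<subseteq> S \<and> length ss \<le> n}"
      using word_of_minimal_length[OF assms(1), of g] by (metis (mono_tags, lifting) image_eqI mem_Collect_eq)
  qed
  show "finite (word_product G ` {ss. set ss \<subseteq> S \<and> length ss \<le> n})"
    using finite_lists_length_le[OF assms(2)] by simp
qed

lemma set_conv_power:
  assumes "g \<in> set_pmf (conv_power G \<mu> n)"
  obtains ss where "set ss \<subseteq> set_pmf \<mu>" "length ss = n" "word_product G ss = g"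
proof -
  have "\<exists>ss. set ss \<subseteq> set_pmf \<mu> \<and> length ss = n \<and> word_product G ss = g"
    using assms
  proof (induction n arbitrary: g)
    case (Suc n)
    then obtain s h where "s \<in> set_pmf \<mu>" "h \<in> set_pmf (conv_power G \<mu> n)" "g = s \<otimes> h"
      by (auto simp: conv_pmf_def)
    moreover from Suc.IH[OF this(2)] obtain ss where
      "set ss \<subseteq> set_pmf \<mu>" "length ss = n" "word_product G ss = h" by blast
    ultimately show ?case by (intro exI[of _ "s # ss"]) auto
  qed auto
  then show ?thesis using that by blast
qed

lemma set_conv_power_subset:
  assumes "set_pmf \<mu> \<subseteq> carrier G"
  shows "set_pmf (conv_power G \<mu> n) \<subseteq> {g \<in> carrier G. word_length G (set_pmf \<mu>) g \<le> n}"
  using assms by (auto elim!: set_conv_power intro!: word_product_closed word_length_le)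

lemma conv_pmf_eq_bind:
  "conv_pmf G \<mu> \<kappa> = bind_pmf \<mu> (\<lambda>g. map_pmf (\<lambda>h. g \<otimes> h) \<kappa>)"
  by (simp add: conv_pmf_def pair_pmf_def map_bind_pmf map_pmf_def bind_assoc_pmf bind_return_pmf)

lemma pmf_conv_pmf:
  assumes "set_pmf \<mu> \<subseteq> carrier G" "set_pmf \<kappa> \<subseteq> carrier G" "g \<in> carrier G"
  shows "pmf (conv_pmf G \<mu> \<kappa>) g = (LINT s|measure_pmf \<mu>. pmf \<kappa> (inv s \<otimes> g))"
  unfolding conv_pmf_eq_bind pmf_bind
proof (intro integral_cong_AE; simp add: AE_measure_pmf_iff; intro ballI)
  fix s assume "s \<in> set_pmf \<mu>"
  then have s: "s \<in> carrier G" using assms by blast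
  have "pmf (map_pmf (\<lambda>h. s \<otimes> h) \<kappa>) g = measure \<kappa> {h. s \<otimes> h = g}"
    by (simp add: pmf_map vimage_def)
  also have "\<dots> = measure \<kappa> {inv s \<otimes> g}"
  proof (rule measure_pmf.finite_measure_eq_AE; simp add: AE_measure_pmf_iff; intro ballI)
    fix h assume "h \<in> set_pmf \<kappa>"
    then have h: "h \<in> carrier G" using assms by blast
    show "(s \<otimes> h = g) = (h = inv s \<otimes> g)"
      using s h assms(3) by (auto simp: m_assoc[symmetric])
  qed
  finally show "pmf (map_pmf (\<lambda>h. s \<otimes> h) \<kappa>) g = pmf \<kappa> (inv s \<otimes> g)"
    by (simp add: pmf.rep_eq)
qed

section \<open>The random walk leaves finite sets\<close>

text \<open>The truncated Green function of the random walk.\<close>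

definition expected_visits :: "'a pmf \<Rightarrow> nat \<Rightarrow> 'a \<Rightarrow> real" where
  "expected_visits \<mu> N g = (\<Sum>n<N. pmf (conv_power G \<mu> n) g)"

lemma expected_visits_nonneg: "0 \<le> expected_visits \<mu> N g"
  by (simp add: expected_visits_def sum_nonneg)

lemma sum_expected_visits_le:
  assumes "finite F"
  shows "(\<Sum>g\<in>F. expected_visits \<mu> N g) \<le> N"
proof -
  have "(\<Sum>g\<in>F. expected_visits \<mu> N g) = (\<Sum>n<N. measure (conv_power G \<mu> n) F)"
    unfolding expected_visits_def using assms
    by (subst sum.swap) (simp add: measure_measure_pmf_finite)
  also have "\<dots> \<le> (\<Sum>n<N. 1)" by (intro sum_mono) simp
  finally show ?thesis by simp
qed

lemma expected_visits_le: "expected_visits \<mu> N g \<le> N"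
  using sum_expected_visits_le[of "{g}" \<mu> N] by simp

text \<open>
  The average over \<open>s\<close> of the visits to \<open>s\<^sup>-\<^sup>1 g\<close> before time \<open>N\<close> counts the visits to \<open>g\<close> at the times
  \<open>1, \<dots>, N\<close>; only a visit at time \<open>0\<close> is missed, which costs at most \<open>1\<close>.
  A single term of an average of nonnegative deficits is bounded by the whole average.
\<close>

lemma visit_deficit_step:
  assumes mu: "set_pmf \<mu> \<subseteq> carrier G" and s: "s \<in> set_pmf \<mu>" and g: "g \<in> carrier G"
    and M: "\<And>h. h \<in> carrier G \<Longrightarrow> expected_visits \<mu> N h \<le> M"
  shows "pmf \<mu> s * (M - expected_visits \<mu> N (inv s \<otimes> g)) \<le> 1 + (M - expected_visits \<mu> N g)"
proof -
  let ?u = "expected_visits \<mu> N"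
  have carr: "set_pmf (conv_power G \<mu> n) \<subseteq> carrier G" for n
    using set_conv_power_subset[OF mu] by blast
  have int: "integrable (measure_pmf \<mu>) (\<lambda>s. pmf \<kappa> (inv s \<otimes> g))" for \<kappa>
    by (intro measure_pmf.integrable_const_bound[where B = 1]) (simp_all add: pmf_le_1)
  have intu: "integrable (measure_pmf \<mu>) (\<lambda>s. ?u (inv s \<otimes> g))"
    unfolding expected_visits_def by (intro Bochner_Integration.integrable_sum int)
  have "?u g \<le> expected_visits \<mu> (Suc N) g"
    by (simp add: expected_visits_def)
  also have "\<dots> = pmf (conv_power G \<mu> 0) g + (\<Sum>n<N. pmf (conv_power G \<mu> (Suc n)) g)"
    unfolding expected_visits_def by (rule sum.lessThan_Suc_shift)
  also have "\<dots> \<le> 1 + (\<Sum>n<N. pmf (conv_power G \<mu> (Suc n)) g)"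
    using pmf_le_1[of "conv_power G \<mu> 0" g] by linarith
  also have "(\<Sum>n<N. pmf (conv_power G \<mu> (Suc n)) g) = (LINT s|measure_pmf \<mu>. ?u (inv s \<otimes> g))"
    unfolding expected_visits_def
    by (simp add: pmf_conv_pmf[OF mu carr g] Bochner_Integration.integral_sum int)
  finally have *: "?u g \<le> 1 + (LINT s|measure_pmf \<mu>. ?u (inv s \<otimes> g))" .
  have "pmf \<mu> s * (M - ?u (inv s \<otimes> g)) \<le> (LINT s|measure_pmf \<mu>. M - ?u (inv s \<otimes> g))"
    using s mu M g expected_visits_nonneg
    by (intro pmf_weighted_le_integral[where B = M]) (auto simp: subset_iff)
  also have "\<dots> = M - (LINT s|measure_pmf \<mu>. ?u (inv s \<otimes> g))"
    using intu by simp
  finally show ?thesis using * by linarith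
qed

text \<open>
  The bound \<open>C\<close> precedes the quantifier over \<open>N\<close>: it depends only on the word and on the initial
  deficit \<open>D\<close>.  This uniformity is what lets the deficits vanish after division by \<open>N\<close>.
\<close>

lemma visit_deficit_word:
  assumes mu: "set_pmf \<mu> \<subseteq> carrier G" and ss: "set ss \<subseteq> set_pmf \<mu>"
  shows "\<exists>C. \<forall>N M g. (\<forall>h\<in>carrier G. expected_visits \<mu> N h \<le> M) \<longrightarrow> g \<in> carrier G \<longrightarrow>
      M - expected_visits \<mu> N g \<le> D \<longrightarrow>
      M - expected_visits \<mu> N (inv (word_product G ss) \<otimes> g) \<le> C"
  using ss
proof (induction ss arbitrary: D)
  case Nil
  then show ?case by (intro exI[of _ D]) auto
next
  case (Cons s ss)
  then have s: "s \<in> set_pmf \<mu>" "s \<in> carrier G" and w: "word_product G ss \<in> carrier G"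
    using mu by (auto intro!: word_product_closed)
  have pos: "0 < pmf \<mu> s" using s by (simp add: pmf_positive)
  \<comment> \<open>One letter turns a deficit \<open>D\<close> at \<open>g\<close> into \<open>(1 + D) / \<mu>(s)\<close> at \<open>s\<^sup>-\<^sup>1 g\<close>; the rest of the word starts there.\<close>
  from Cons.prems have "set ss \<subseteq> set_pmf \<mu>" by simp
  from Cons.IH[OF this, of "(1 + D) / pmf \<mu> s"] obtain C where
    C: "\<forall>N M g. (\<forall>h\<in>carrier G. expected_visits \<mu> N h \<le> M) \<longrightarrow> g \<in> carrier G \<longrightarrow>
      M - expected_visits \<mu> N g \<le> (1 + D) / pmf \<mu> s \<longrightarrow>
      M - expected_visits \<mu> N (inv (word_product G ss) \<otimes> g) \<le> C"
    by (rule exE)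
  show ?case
  proof (intro exI[of _ C] allI impI)
    fix N M g
    assume M: "\<forall>h\<in>carrier G. expected_visits \<mu> N h \<le> M" and g: "g \<in> carrier G"
      and D: "M - expected_visits \<mu> N g \<le> D"
    have "pmf \<mu> s * (M - expected_visits \<mu> N (inv s \<otimes> g)) \<le> 1 + D"
      using visit_deficit_step[OF mu s(1) g, of N M] M D by simp
    then have "M - expected_visits \<mu> N (inv s \<otimes> g) \<le> (1 + D) / pmf \<mu> s"
      using pos by (simp add: field_simps)
    from C[rule_format, OF bspec[OF M] _ this] show
      "M - expected_visits \<mu> N (inv (word_product G (s # ss)) \<otimes> g) \<le> C"
      using s g w by (simp add: inv_mult_group m_assoc)
  qed
qed

text \<open>
  A near-maximizer \<open>h\<close> of the number of visits yields \<open>k\<close> distinct near-maximizers \<open>f\<^sup>-\<^sup>1 h\<close>, one for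
  each \<open>f\<close> in a \<open>k\<close>-element set \<open>F\<close>, whose visits add up to at most \<open>N\<close>.
\<close>

lemma expected_visits_sublinear:
  assumes mu: "set_pmf \<mu> \<subseteq> carrier G" and gen: "generates G (set_pmf \<mu>)"
    and inf: "infinite (carrier G)" and g: "g \<in> carrier G"
  shows "(\<lambda>N. expected_visits \<mu> N g / N) \<longlonglongrightarrow> 0"
proof (rule LIMSEQ_I)
  fix e :: real assume e: "0 < e"
  \<comment> \<open>Half of \<open>e\<close> pays for \<open>N / k\<close>, the other half for the constant \<open>sum C F\<close>.\<close>
  obtain k :: nat where k: "2 / e < k" using reals_Archimedean2 by blast
  then have k0: "0 < k" using e by (cases k) (auto simp: field_simps)
  obtain F where F: "F \<subseteq> carrier G" "finite F" "card F = k"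
    using inf infinite_arbitrarily_large by blast
  have "\<exists>C. \<forall>N M h. (\<forall>h\<in>carrier G. expected_visits \<mu> N h \<le> M) \<longrightarrow> h \<in> carrier G \<longrightarrow>
      M - expected_visits \<mu> N h \<le> 1 \<longrightarrow> M - expected_visits \<mu> N (inv f \<otimes> h) \<le> C"
    if "f \<in> F" for f
  proof -
    have "f \<in> carrier G" using that F(1) by blast
    then obtain ss where ss: "set ss \<subseteq> set_pmf \<mu>" "word_product G ss = f"
      using word_of_minimal_length[OF gen] by metis
    show ?thesis using visit_deficit_word[OF mu ss(1), of 1] unfolding ss(2) .
  qed
  then obtain C where C: "\<And>f N M h. f \<in> F \<Longrightarrow> \<forall>h\<in>carrier G. expected_visits \<mu> N h \<le> M \<Longrightarrow>
      h \<in> carrier G \<Longrightarrow> M - expected_visits \<mu> N h \<le> 1 \<Longrightarrow>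
      M - expected_visits \<mu> N (inv f \<otimes> h) \<le> C f"
    by metis
  \<comment> \<open>\<open>F\<close> and \<open>C\<close> are chosen before \<open>N\<close>, so the error term \<open>sum C F\<close> does not grow with \<open>N\<close>.\<close>
  have bound: "k * expected_visits \<mu> N g \<le> N + sum C F" for N
  proof -
    let ?u = "expected_visits \<mu> N"
    define M where "M = (SUP h\<in>carrier G. ?u h)"
    have bdd: "bdd_above (?u ` carrier G)"
      by (intro bdd_aboveI[of _ "real N"]) (auto intro: expected_visits_le)
    have M: "\<forall>h\<in>carrier G. ?u h \<le> M"
      unfolding M_def by (intro ballI cSUP_upper bdd)
    have "\<exists>x\<in>?u ` carrier G. M - 1 < x"
      unfolding M_def using g by (subst less_cSup_iff[symmetric]) (auto intro: bdd)
    then obtain h where h: "h \<in> carrier G" "M - ?u h \<le> 1"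
      by (auto simp: algebra_simps dest: less_imp_le)
    have inj: "inj_on (\<lambda>f. inv f \<otimes> h) F"
      using F h(1) by (intro inj_onI) (metis inv_closed inv_inv right_cancel subsetD)
    have "k * M - sum C F = (\<Sum>f\<in>F. M - C f)"
      by (simp add: sum_subtractf F)
    also have "\<dots> \<le> (\<Sum>f\<in>F. ?u (inv f \<otimes> h))"
      using C[OF _ M h] by (intro sum_mono) (simp add: algebra_simps)
    also have "\<dots> = (\<Sum>x\<in>(\<lambda>f. inv f \<otimes> h) ` F. ?u x)"
      using inj by (simp add: sum.reindex)
    also have "\<dots> \<le> N" using F by (intro sum_expected_visits_le) simp
    finally have "k * M \<le> N + sum C F" by simp
    moreover have "k * ?u g \<le> k * M" using M g by (intro mult_left_mono) auto
    ultimately show ?thesis by linarith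
  qed
  obtain N0 :: nat where N0: "2 * \<bar>sum C F\<bar> / (e * k) < N0" using reals_Archimedean2 by blast
  show "\<exists>no. \<forall>N\<ge>no. norm (expected_visits \<mu> N g / real N - 0) < e"
  proof (intro exI[of _ "Suc N0"] allI impI)
    fix N assume "Suc N0 \<le> N"
    then have N: "0 < N" "2 * \<bar>sum C F\<bar> / (e * k) < N" using N0 by auto
    then have "2 * sum C F < e * k * N" using e k0 by (simp add: field_simps abs_if split: if_splits)
    moreover have "2 * real N < e * k * N" using k e N by (simp add: field_simps)
    ultimately have "k * expected_visits \<mu> N g < k * (e * N)" using bound[of N] by (simp add: algebra_simps)
    then have "expected_visits \<mu> N g < e * N" using k0 by simp
    then show "norm (expected_visits \<mu> N g / real N - 0) < e"
      using N expected_visits_nonneg[of \<mu> N g] by (simp add: field_simps)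
  qed
qed

section \<open>Expectations under evenly distributed measures\<close>

text \<open>
  Every element of the support other than \<open>\<one>\<close> has word length \<open>1\<close>, hence the same positive mass;
  only finitely many elements can have it.
\<close>

lemma evenly_distributed_finite_support:
  assumes mu: "set_pmf \<mu> \<subseteq> carrier G" and ev: "evenly_distributed G \<mu>"
  shows "finite (set_pmf \<mu>)"
proof (rule ccontr)
  assume "infinite (set_pmf \<mu>)"
  then have inf: "infinite (set_pmf \<mu> - {\<one>})" by simp
  have pow1: "conv_power G \<mu> 1 = \<mu>"
  proof -
    have "conv_power G \<mu> 1 = map_pmf (\<lambda>g. g \<otimes> \<one>) \<mu>"
      by (simp add: conv_pmf_eq_bind map_pmf_def bind_return_pmf)
    also have "\<dots> = map_pmf (\<lambda>g. g) \<mu>"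
      using mu by (intro map_pmf_cong) auto
    finally show ?thesis by simp
  qed
  obtain c where "\<forall>g\<in>carrier G. word_length G (set_pmf \<mu>) g = 1 \<longrightarrow> pmf (conv_power G \<mu> 1) g = c"
    using ev unfolding evenly_distributed_def by blast
  then have c: "pmf \<mu> g = c" if "g \<in> set_pmf \<mu> - {\<one>}" for g
    using that mu word_length_generator[of g "set_pmf \<mu>"] unfolding pow1 by auto
  obtain s where "s \<in> set_pmf \<mu> - {\<one>}" using inf by (metis ex_in_conv finite.emptyI)
  then have cpos: "0 < c" using c[of s] pmf_positive[of s \<mu>] by simp
  obtain k :: nat where k: "1 / c < k" using reals_Archimedean2 by blast
  obtain F where F: "F \<subseteq> set_pmf \<mu> - {\<one>}" "finite F" "card F = k"
    using inf infinite_arbitrarily_large by blast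
  have "k * c = sum (pmf \<mu>) F"
    using F c by (simp add: subset_iff)
  also have "\<dots> = measure \<mu> F" using F by (simp add: measure_measure_pmf_finite)
  also have "\<dots> \<le> 1" by simp
  finally show False using k cpos by (simp add: field_simps)
qed

text \<open>
  A measure with constant mass on each sphere does not see the difference between a function and
  its average over spheres.  For an empty sphere the average is \<open>0\<close>, and the sphere contributes
  nothing to either side.
\<close>

lemma expectation_radial:
  fixes F :: "'a \<Rightarrow> real"
  assumes gen: "generates G S" and fin: "finite S"
    and supp: "set_pmf p \<subseteq> {g \<in> carrier G. word_length G S g \<le> n}"
    and radial: "\<And>m. \<exists>c. \<forall>g\<in>carrier G. word_length G S g = m \<longrightarrow> pmf p g = c"
  shows "(LINT g|measure_pmf p. F g) =
    (LINT g|measure_pmf p. 1 / card (word_sphere G S (word_length G S g)) *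
       (\<Sum>h\<in>word_sphere G S (word_length G S g). F h))"
proof -
  let ?B = "{g \<in> carrier G. word_length G S g \<le> n}" and ?S = "word_sphere G S"
  let ?A = "\<lambda>m. 1 / card (?S m) * (\<Sum>h\<in>?S m. F h)"
  have B: "finite ?B" by (rule finite_word_ball[OF gen fin])
  obtain c where c: "\<And>g. g \<in> carrier G \<Longrightarrow> pmf p g = c (word_length G S g)"
    using radial by metis
  have group: "(LINT g|measure_pmf p. H g) = (\<Sum>m\<le>n. c m * (\<Sum>g\<in>?S m. H g))" for H :: "'a \<Rightarrow> real"
  proof -
    have "(LINT g|measure_pmf p. H g) = (\<Sum>g\<in>?B. H g * pmf p g)"
      using supp by (intro integral_measure_pmf_real[OF B]) blast
    also have "\<dots> = (\<Sum>m\<le>n. \<Sum>g\<in>{g\<in>?B. word_length G S g = m}. H g * pmf p g)"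
      by (rule sum.group[symmetric]) (use B in auto)
    also have "\<dots> = (\<Sum>m\<le>n. c m * (\<Sum>g\<in>?S m. H g))"
      by (intro sum.cong refl) (auto simp: word_sphere_def sum_distrib_left c mult.commute intro!: sum.cong)
    finally show ?thesis .
  qed
  have "(\<Sum>g\<in>?S m. ?A (word_length G S g)) = (\<Sum>g\<in>?S m. F g)" if "m \<le> n" for m
  proof -
    have S: "finite (?S m)" using that by (intro finite_subset[OF _ B]) (auto simp: word_sphere_def)
    have "(\<Sum>g\<in>?S m. ?A (word_length G S g)) = (\<Sum>g\<in>?S m. ?A m)"
      by (intro sum.cong refl) (simp add: word_sphere_def)
    also have "\<dots> = (\<Sum>g\<in>?S m. F g)" using S by (cases "?S m = {}") simp_all
    finally show ?thesis .
  qed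
  then show ?thesis by (simp add: group)
qed

text \<open>
  A Toeplitz argument: \<open>A\<close> is close to its limit outside a finite ball, and the ball has
  asymptotically no mass under the Cesaro means of the convolution powers.
\<close>

lemma cesaro_expectation_word_length:
  fixes A :: "nat \<Rightarrow> real"
  assumes mu: "set_pmf \<mu> \<subseteq> carrier G" and gen: "generates G (set_pmf \<mu>)"
    and fin: "finite (set_pmf \<mu>)" and inf: "infinite (carrier G)" and A: "A \<longlonglongrightarrow> a"
  shows "(\<lambda>N. (\<Sum>n<N. LINT g|measure_pmf (conv_power G \<mu> n). A (word_length G (set_pmf \<mu>) g)) / N)
    \<longlonglongrightarrow> a"
proof (rule LIMSEQ_I)
  fix e :: real assume e: "0 < e"
  let ?L = "word_length G (set_pmf \<mu>)" and ?p = "conv_power G \<mu>"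
  obtain m0 where m0: "\<And>m. m0 \<le> m \<Longrightarrow> \<bar>A m - a\<bar> < e / 2"
    using LIMSEQ_D[OF A, of "e / 2"] e by (metis half_gt_zero real_norm_def)
  have "Bseq (\<lambda>m. A m - a)"
    by (rule convergent_imp_Bseq) (use A in \<open>auto intro!: convergentI tendsto_intros\<close>)
  then obtain K where K: "0 < K" "\<And>m. \<bar>A m - a\<bar> \<le> K"
    by (auto simp: Bseq_def)
  define B where "B = {g \<in> carrier G. ?L g \<le> m0}"
  have B: "finite B" unfolding B_def by (rule finite_word_ball[OF gen fin])
  have supp: "g \<in> carrier G" if "g \<in> set_pmf (?p n)" for g n
    using that set_conv_power_subset[OF mu] by blast
  have bdd: "\<exists>c. \<forall>m. \<bar>A m\<bar> \<le> c"
  proof (intro exI allI)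
    show "\<bar>A m\<bar> \<le> K + \<bar>a\<bar>" for m using K(2)[of m] by linarith
  qed
  have intA: "integrable (measure_pmf (?p n)) (\<lambda>g. A (?L g))" for n
  proof -
    obtain c where "\<And>m. \<bar>A m\<bar> \<le> c" using bdd by blast
    then show ?thesis by (intro measure_pmf.integrable_const_bound[where B = c]) simp_all
  qed
  have one: "\<bar>(LINT g|measure_pmf (?p n). A (?L g)) - a\<bar> \<le> e / 2 + K * measure (?p n) B" for n
  proof -
    have "\<bar>(LINT g|measure_pmf (?p n). A (?L g)) - a\<bar> = \<bar>LINT g|measure_pmf (?p n). A (?L g) - a\<bar>"
      using intA by simp
    also have "\<dots> \<le> (LINT g|measure_pmf (?p n). \<bar>A (?L g) - a\<bar>)"
      by (rule integral_abs_bound)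
    also have "\<dots> \<le> (LINT g|measure_pmf (?p n). e / 2 + K * indicator B g)"
    proof (rule integral_mono_AE)
      show "AE g in measure_pmf (?p n). \<bar>A (?L g) - a\<bar> \<le> e / 2 + K * indicator B g"
        unfolding AE_measure_pmf_iff
      proof
        fix g assume "g \<in> set_pmf (?p n)"
        then show "\<bar>A (?L g) - a\<bar> \<le> e / 2 + K * indicator B g"
          using supp K(2)[of "?L g"] m0[of "?L g"] e by (auto simp: B_def indicator_def)
      qed
      show "integrable (measure_pmf (?p n)) (\<lambda>g. e / 2 + K * indicator B g)"
        using e K(1) by (intro measure_pmf.integrable_const_bound[where B = "e / 2 + K"])
          (simp_all add: indicator_def)
    qed (use intA in simp)
    also have "\<dots> = e / 2 + K * measure (?p n) B"
    proof -
      have "integrable (measure_pmf (?p n)) (indicator B :: _ \<Rightarrow> real)"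
        by (intro measure_pmf.integrable_const_bound[where B = 1]) (simp_all add: indicator_def)
      then show ?thesis by simp
    qed
    finally show ?thesis .
  qed
  have "(\<lambda>N. K * (\<Sum>g\<in>B. expected_visits \<mu> N g / N)) \<longlonglongrightarrow> K * (\<Sum>g\<in>B. 0)"
    by (intro tendsto_intros expected_visits_sublinear[OF mu gen inf]) (simp add: B_def)
  then obtain N0 where N0: "\<And>N. N0 \<le> N \<Longrightarrow> K * (\<Sum>g\<in>B. expected_visits \<mu> N g / N) < e / 2"
    using LIMSEQ_D[of _ 0 "e / 2"] e by (fastforce simp: abs_less_iff)
  show "\<exists>no. \<forall>N\<ge>no. norm ((\<Sum>n<N. LINT g|measure_pmf (?p n). A (?L g)) / real N - a) < e"
  proof (intro exI[of _ "Suc N0"] allI impI)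
    fix N assume N: "Suc N0 \<le> N"
    have mass: "(\<Sum>n<N. measure (?p n) B) = (\<Sum>g\<in>B. expected_visits \<mu> N g)"
      unfolding expected_visits_def using B by (subst sum.swap) (simp add: measure_measure_pmf_finite)
    have "\<bar>(\<Sum>n<N. LINT g|measure_pmf (?p n). A (?L g)) - N * a\<bar>
        = \<bar>\<Sum>n<N. (LINT g|measure_pmf (?p n). A (?L g)) - a\<bar>"
      by (simp add: sum_subtractf)
    also have "\<dots> \<le> (\<Sum>n<N. \<bar>(LINT g|measure_pmf (?p n). A (?L g)) - a\<bar>)"
      by (rule sum_abs)
    also have "\<dots> \<le> (\<Sum>n<N. e / 2 + K * measure (?p n) B)"
      by (intro sum_mono one)
    also have "\<dots> = N * (e / 2) + K * (\<Sum>g\<in>B. expected_visits \<mu> N g)"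
      by (simp add: sum.distrib sum_distrib_left[symmetric] mass)
    finally have *: "\<bar>(\<Sum>n<N. LINT g|measure_pmf (?p n). A (?L g)) - N * a\<bar>
        \<le> N * (e / 2) + K * (\<Sum>g\<in>B. expected_visits \<mu> N g)" .
    have Npos: "0 < real N" using N by simp
    have "K * (\<Sum>g\<in>B. expected_visits \<mu> N g) < N * (e / 2)"
      using N0[of N] N Npos by (simp add: sum_divide_distrib[symmetric] field_simps)
    with * have "\<bar>(\<Sum>n<N. LINT g|measure_pmf (?p n). A (?L g)) - N * a\<bar> < N * e" by simp
    moreover have "(\<Sum>n<N. LINT g|measure_pmf (?p n). A (?L g)) / real N - a =
        ((\<Sum>n<N. LINT g|measure_pmf (?p n). A (?L g)) - N * a) / N"
      using Npos by (simp add: field_simps)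
    ultimately show "norm ((\<Sum>n<N. LINT g|measure_pmf (?p n). A (?L g)) / real N - a) < e"
      using Npos by (simp add: abs_divide field_simps)
  qed
qed

end


section \<open>Invariance of the space average\<close>

text \<open>
  The recursion for convolution powers multiplies by the new factor on the left, so this factor
  acts last: it can be absorbed into the function, leaving the starting point \<open>x\<close> unchanged.
\<close>

lemma (in group) expectation_conv_power_Suc:
  fixes f :: "'x \<Rightarrow> real"
  assumes act: "group_action G UNIV \<phi>" and mu: "set_pmf \<mu> \<subseteq> carrier G" and fin: "finite (set_pmf \<mu>)"
    and gen: "generates G (set_pmf \<mu>)"
  shows "(LINT g|measure_pmf (conv_power G \<mu> (Suc n)). f (\<phi> g x)) =
    (LINT g|measure_pmf (conv_power G \<mu> n). LINT s|measure_pmf \<mu>. f (\<phi> s (\<phi> g x)))"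
proof -
  let ?p = "conv_power G \<mu> n"
  have supp: "set_pmf ?p \<subseteq> {g \<in> carrier G. word_length G (set_pmf \<mu>) g \<le> n}"
    by (rule set_conv_power_subset[OF mu])
  have finp: "finite (set_pmf ?p)"
    using finite_subset[OF supp finite_word_ball[OF gen fin]] .
  have "(LINT g|measure_pmf (conv_power G \<mu> (Suc n)). f (\<phi> g x)) =
      (\<Sum>s\<in>set_pmf \<mu>. pmf \<mu> s * (LINT h|measure_pmf ?p. f (\<phi> (s \<otimes> h) x)))"
    using fin finp by (simp add: conv_pmf_eq_bind pmf_expectation_bind[OF fin _ order_refl])
  also have "\<dots> = (\<Sum>s\<in>set_pmf \<mu>. pmf \<mu> s * (LINT h|measure_pmf ?p. f (\<phi> s (\<phi> h x))))"
  proof (intro sum.cong refl arg_cong2[where f = "(*)"] integral_cong_AE)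
    fix s assume s: "s \<in> set_pmf \<mu>"
    show "AE h in measure_pmf ?p. f (\<phi> (s \<otimes> h) x) = f (\<phi> s (\<phi> h x))"
      unfolding AE_measure_pmf_iff
    proof
      fix h assume "h \<in> set_pmf ?p"
      then have "\<phi> (s \<otimes> h) x = \<phi> s (\<phi> h x)"
        using s mu supp by (intro group_action.composition_rule[OF act]) auto
      then show "f (\<phi> (s \<otimes> h) x) = f (\<phi> s (\<phi> h x))" by simp
    qed
  qed simp_all
  also have "\<dots> = (LINT h|measure_pmf ?p. (\<Sum>s\<in>set_pmf \<mu>. pmf \<mu> s * f (\<phi> s (\<phi> h x))))"
    using integrable_measure_pmf_finite[OF finp]
    by (subst Bochner_Integration.integral_sum) auto
  also have "\<dots> = (LINT h|measure_pmf ?p. LINT s|measure_pmf \<mu>. f (\<phi> s (\<phi> h x)))"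
    by (simp add: integral_measure_pmf[OF fin])
  finally show ?thesis .
qed

text \<open>
  Both sides are limits of Cesaro means along the orbit of one point, for the function \<open>P f\<close> and for
  \<open>f\<close>.  The step from \<open>f\<close> to \<open>P f\<close> shifts time by one, which the means do not notice.
\<close>

lemma (in group) integral_average_invariant:
  fixes f :: "'x::topological_space \<Rightarrow> real"
  assumes act: "continuous_action G \<phi>" and comp: "compact (UNIV :: 'x set)"
    and mu: "set_pmf \<mu> \<subseteq> carrier G" and gen: "generates G (set_pmf \<mu>)"
    and inf: "infinite (carrier G)" and ev: "evenly_distributed G \<mu>"
    and conv: "converges_to_space_average G (set_pmf \<mu>) \<phi> \<nu>"
    and f: "continuous_on UNIV f"
  shows "(LINT y|\<nu>. LINT s|measure_pmf \<mu>. f (\<phi> s y)) = (LINT y|\<nu>. f y)"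
proof -
  have fin: "finite (set_pmf \<mu>)" by (rule evenly_distributed_finite_support[OF mu ev])
  have act': "group_action G UNIV \<phi>" and cont: "\<And>g. g \<in> carrier G \<Longrightarrow> continuous_on UNIV (\<phi> g)"
    using act by (auto simp: continuous_action_def)
  \<comment> \<open>The limit of the sphere averages is the same at every point, so any \<open>x\<close> will do.\<close>
  define x :: 'x where "x = undefined"
  define E where "E n h = (LINT g|measure_pmf (conv_power G \<mu> n). h (\<phi> g x))" for n and h :: "'x \<Rightarrow> real"
  define P where "P y = (LINT s|measure_pmf \<mu>. f (\<phi> s y))" for y
  have lim: "(\<lambda>N. (\<Sum>n<N. E n h) / N) \<longlonglongrightarrow> (LINT y|\<nu>. h y)" if h: "continuous_on UNIV h" for h
  proof -
    have "E n h = (LINT g|measure_pmf (conv_power G \<mu> n).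
        sphere_average G (set_pmf \<mu>) \<phi> (word_length G (set_pmf \<mu>) g) h x)" for n
      unfolding E_def sphere_average_def
      by (rule expectation_radial[OF gen fin set_conv_power_subset[OF mu]])
        (use ev in \<open>unfold evenly_distributed_def, blast\<close>)
    moreover have "(\<lambda>m. sphere_average G (set_pmf \<mu>) \<phi> m h x) \<longlonglongrightarrow> (LINT y|\<nu>. h y)"
      using h conv unfolding converges_to_space_average_def by blast
    ultimately show ?thesis
      using cesaro_expectation_word_length[OF mu gen fin inf] by simp
  qed
  have step: "E (Suc n) f = E n P" for n
    unfolding E_def P_def by (rule expectation_conv_power_Suc[OF act' mu fin gen])
  have "P = (\<lambda>y. \<Sum>s\<in>set_pmf \<mu>. pmf \<mu> s * f (\<phi> s y))"
    by (simp add: fun_eq_iff P_def integral_measure_pmf[OF fin])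
  moreover have "continuous_on UNIV (\<lambda>y. f (\<phi> s y))" if "s \<in> set_pmf \<mu>" for s
    using continuous_on_compose2[OF f cont] that mu by blast
  ultimately have P: "continuous_on UNIV P" by (auto intro!: continuous_intros)
  have "bounded (range f)" using compact_continuous_image[OF f comp] by (rule compact_imp_bounded)
  then obtain K where K: "\<And>y. \<bar>f y\<bar> \<le> K" by (auto simp: bounded_iff)
  have EK: "\<bar>E n f\<bar> \<le> K" for n
  proof -
    have "\<bar>E n f\<bar> \<le> (LINT g|measure_pmf (conv_power G \<mu> n). \<bar>f (\<phi> g x)\<bar>)"
      unfolding E_def by (rule integral_abs_bound)
    also have "\<dots> \<le> (LINT g|measure_pmf (conv_power G \<mu> n). K)"
      using K order_trans[OF abs_ge_zero K]
      by (intro integral_mono measure_pmf.integrable_const_bound[where B = K]) auto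
    finally show ?thesis by simp
  qed
  have "(\<lambda>N. (\<Sum>n<N. E n P) / N - (\<Sum>n<N. E n f) / N) \<longlonglongrightarrow> 0"
  proof (rule Lim_null_comparison)
    have "(\<Sum>n<N. E n P) / N - (\<Sum>n<N. E n f) / N = (E N f - E 0 f) / N" for N
      using sum_lessThan_telescope[of "\<lambda>n. E n f" N]
      by (simp add: step diff_divide_distrib[symmetric] sum_subtractf)
    moreover have "\<bar>E N f - E 0 f\<bar> \<le> 2 * K" for N using EK[of N] EK[of 0] by linarith
    ultimately show "\<forall>\<^sub>F N in sequentially.
        norm ((\<Sum>n<N. E n P) / N - (\<Sum>n<N. E n f) / N) \<le> 2 * K / N"
      by (simp add: abs_divide divide_right_mono)
    show "(\<lambda>N. 2 * K / real N) \<longlonglongrightarrow> 0" by (rule lim_const_over_n)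
  qed
  then have "(LINT y|\<nu>. P y) - (LINT y|\<nu>. f y) = 0"
    by (rule LIMSEQ_unique[OF tendsto_diff[OF lim[OF P] lim[OF f]]])
  then show ?thesis by (simp add: P_def)
qed

section \<open>Uniqueness of the representing measure\<close>

lemma regular_borel_measure_inner:
  assumes "regular_borel_measure \<nu>" "A \<in> sets borel" "0 < e"
  obtains K where "compact K" "K \<subseteq> A" "measure \<nu> A \<le> measure \<nu> K + e"
proof -
  interpret finite_measure \<nu> using assms by (simp add: regular_borel_measure_def)
  show thesis
  proof (cases "measure \<nu> A \<le> e")
    case True
    then show ?thesis using that[of "{}"] by simp
  next
    case False
    then have "ennreal (measure \<nu> A - e) < emeasure \<nu> A"
      using assms(3) by (simp add: emeasure_eq_measure ennreal_less_iff)
    also have "\<dots> = (SUP K\<in>{K. compact K \<and> K \<subseteq> A}. emeasure \<nu> K)"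
      using assms(1,2) unfolding regular_borel_measure_def by metis
    finally obtain K where "compact K" "K \<subseteq> A" "ennreal (measure \<nu> A - e) < emeasure \<nu> K"
      by (auto simp: less_SUP_iff)
    then show ?thesis using that[of K] False by (simp add: emeasure_eq_measure ennreal_less_iff)
  qed
qed

lemma regular_borel_measure_outer:
  assumes "regular_borel_measure \<nu>" "A \<in> sets borel" "0 < e"
  obtains U where "open U" "A \<subseteq> U" "measure \<nu> U \<le> measure \<nu> A + e"
proof -
  interpret finite_measure \<nu> using assms by (simp add: regular_borel_measure_def)
  have "(INF U\<in>{U. open U \<and> A \<subseteq> U}. emeasure \<nu> U) = emeasure \<nu> A"
    using assms(1,2) unfolding regular_borel_measure_def by metis
  also have "\<dots> < ennreal (measure \<nu> A + e)"
    using assms(3) by (simp add: emeasure_eq_measure ennreal_less_iff)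
  finally obtain U where "open U" "A \<subseteq> U" "emeasure \<nu> U < ennreal (measure \<nu> A + e)"
    by (auto simp: INF_less_iff)
  then show ?thesis using that[of U] by (simp add: emeasure_eq_measure ennreal_less_iff)
qed

lemma compact_Hausdorff_Urysohn:
  fixes K U :: "'x::t2_space set"
  assumes comp: "compact (UNIV :: 'x set)" and K: "compact K" and U: "open U" and "K \<subseteq> U"
  obtains f :: "'x \<Rightarrow> real" where "continuous_on UNIV f" "\<And>x. 0 \<le> f x" "\<And>x. f x \<le> 1"
    "\<And>x. x \<in> K \<Longrightarrow> f x = 1" "\<And>x. x \<notin> U \<Longrightarrow> f x = 0"
proof -
  have "compact_space (euclidean :: 'x topology)"
    using comp by (simp add: compact_space_def)
  moreover have "Hausdorff_space (euclidean :: 'x topology)"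
    unfolding Hausdorff_space_def using hausdorff by (fastforce simp: disjnt_def)
  ultimately have "normal_space (euclidean :: 'x topology)"
    using compact_Hausdorff_or_regular_imp_normal_space by blast
  moreover have "closedin euclidean (- U)" "closedin euclidean K"
    using U compact_imp_closed[OF K] by auto
  moreover have "disjnt (- U) K" using \<open>K \<subseteq> U\<close> by (auto simp: disjnt_def)
  ultimately obtain f :: "'x \<Rightarrow> real" where f: "continuous_map euclidean (top_of_set {0..1}) f"
      "f ` (- U) \<subseteq> {0}" "f ` K \<subseteq> {1}"
    using Urysohn_lemma[of euclidean "- U" K 0 1] by (metis zero_le_one)
  have "continuous_on UNIV f" "\<And>x. f x \<in> {0..1}"
    using f(1) by (auto simp: continuous_map_in_subtopology)
  then show ?thesis using that[of f] f by (auto simp: image_subset_iff)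
qed

text \<open>
  An Urysohn function squeezed between the indicators of \<open>K\<close> and of an open neighbourhood \<open>U\<close>
  transfers the comparison of integrals; outer regularity of \<open>\<nu>\<close> shrinks \<open>U\<close> to \<open>K\<close>.
\<close>

lemma compact_measure_le_if_integrals_le:
  fixes \<nu> :: "'x::t2_space measure"
  assumes comp: "compact (UNIV :: 'x set)" and reg: "regular_borel_measure \<nu>"
    and L: "finite_measure \<rho>" "sets \<rho> = sets borel"
    and le: "\<And>f :: 'x \<Rightarrow> real. continuous_on UNIV f \<Longrightarrow> (LINT x|\<rho>. f x) \<le> (LINT x|\<nu>. f x)"
    and K: "compact K"
  shows "measure \<rho> K \<le> measure \<nu> K"
proof (rule field_le_epsilon)
  fix e :: real assume "0 < e"
  interpret L: finite_measure \<rho> by fact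
  interpret N: finite_measure \<nu> using reg by (simp add: regular_borel_measure_def)
  have sets: "sets \<nu> = sets borel" using reg by (simp add: regular_borel_measure_def)
  have Kb: "K \<in> sets borel" using K by (simp add: borel_compact)
  obtain U where U: "open U" "K \<subseteq> U" "measure \<nu> U \<le> measure \<nu> K + e"
    using regular_borel_measure_outer[OF reg Kb \<open>0 < e\<close>] .
  obtain f :: "'x \<Rightarrow> real" where f: "continuous_on UNIV f" "\<And>x. 0 \<le> f x" "\<And>x. f x \<le> 1"
    "\<And>x. x \<in> K \<Longrightarrow> f x = 1" "\<And>x. x \<notin> U \<Longrightarrow> f x = 0"
    using compact_Hausdorff_Urysohn[OF comp K U(1,2)] by metis
  have fm: "f \<in> borel_measurable borel" by (rule borel_measurable_continuous_onI[OF f(1)])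
  have int: "integrable \<rho> f" "integrable \<nu> f"
    using f(2,3) fm
    by (auto intro!: L.integrable_const_bound[where B = 1] N.integrable_const_bound[where B = 1]
      simp: measurable_cong_sets[OF L(2) refl] measurable_cong_sets[OF sets refl])
  have "measure \<rho> K = (LINT x|\<rho>. indicator K x)"
    using Kb L sets_eq_imp_space_eq[OF L(2)] by simp
  also have "\<dots> \<le> (LINT x|\<rho>. f x)"
  proof (rule integral_mono)
    show "integrable \<rho> (indicator K :: 'x \<Rightarrow> real)"
      using Kb L by (intro integrable_real_indicator) (simp_all add: L.emeasure_eq_measure)
  qed (use int f in \<open>auto simp: indicator_def\<close>)
  also have "\<dots> \<le> (LINT x|\<nu>. f x)" by (rule le[OF f(1)])
  also have "\<dots> \<le> (LINT x|\<nu>. indicator U x)"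
  proof (rule integral_mono)
    show "integrable \<nu> (indicator U :: 'x \<Rightarrow> real)"
      using U(1) sets by (intro integrable_real_indicator) (simp_all add: N.emeasure_eq_measure)
  qed (use int f in \<open>auto simp: indicator_def\<close>)
  also have "\<dots> = measure \<nu> U"
    using U(1) sets sets_eq_imp_space_eq[OF sets] by simp
  finally show "measure \<rho> K \<le> measure \<nu> K + e" using U(3) by simp
qed

text \<open>
  Outer regularity on one side and inner regularity on the other give \<open>\<rho> \<le> \<nu>\<close> on all Borel sets.
  Equal total mass turns this into equality by passing to complements.
\<close>

lemma regular_borel_measure_eqI:
  fixes \<nu> :: "'x::t2_space measure"
  assumes comp: "compact (UNIV :: 'x set)" and reg: "regular_borel_measure \<nu>"
    and L: "finite_measure \<rho>" "sets \<rho> = sets borel"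
    and inner: "\<And>A e. A \<in> sets borel \<Longrightarrow> 0 < e \<Longrightarrow>
      \<exists>K. compact K \<and> K \<subseteq> A \<and> measure \<rho> A \<le> measure \<rho> K + e"
    and eq: "\<And>f :: 'x \<Rightarrow> real. continuous_on UNIV f \<Longrightarrow> (LINT x|\<rho>. f x) = (LINT x|\<nu>. f x)"
  shows "\<rho> = \<nu>"
proof (rule measure_eqI)
  interpret L: finite_measure \<rho> by fact
  interpret N: finite_measure \<nu> using reg by (simp add: regular_borel_measure_def)
  have sets: "sets \<nu> = sets borel" using reg by (simp add: regular_borel_measure_def)
  have sp: "space \<rho> = UNIV" "space \<nu> = UNIV"
    using sets_eq_imp_space_eq[OF L(2)] sets_eq_imp_space_eq[OF sets] by simp_all
  show "sets \<rho> = sets \<nu>" using L sets by simp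
  have le: "measure \<rho> A \<le> measure \<nu> A" if A: "A \<in> sets borel" for A
  proof (rule field_le_epsilon)
    fix e :: real assume "0 < e"
    from inner[OF A this] obtain K where K: "compact K" "K \<subseteq> A" "measure \<rho> A \<le> measure \<rho> K + e"
      by blast
    have "measure \<rho> K \<le> measure \<nu> K"
      using eq by (intro compact_measure_le_if_integrals_le[OF comp reg L _ K(1)]) simp
    also have "\<dots> \<le> measure \<nu> A"
      using A K(2) sets by (intro N.finite_measure_mono) auto
    finally show "measure \<rho> A \<le> measure \<nu> A + e" using K(3) by simp
  qed
  have total: "measure \<rho> UNIV = measure \<nu> UNIV"
    using eq[of "\<lambda>_. 1"] by (simp add: sp)
  fix A assume "A \<in> sets \<rho>"
  then have A: "A \<in> sets borel" using L by simp
  have "measure \<rho> (UNIV - A) \<le> measure \<nu> (UNIV - A)" using A by (intro le) auto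
  then have "measure \<nu> A \<le> measure \<rho> A"
    using A L.finite_measure_compl[of A] N.finite_measure_compl[of A] by (simp add: sp L sets total)
  with le[OF A] show "emeasure \<rho> A = emeasure \<nu> A"
    by (simp add: L.emeasure_eq_measure N.emeasure_eq_measure)
qed

text \<open>
  Choose for each of the finitely many \<open>g\<close> in the support a compact \<open>k g \<subseteq> g\<^sup>-\<^sup>1 A\<close>; the union of the
  images \<open>g (k g)\<close> is a compact subset of \<open>A\<close> that works for all translates at once.
\<close>

lemma action_conv_inner_regular:
  fixes \<phi> :: "'g \<Rightarrow> 'x \<Rightarrow> 'x::t2_space"
  assumes cont: "\<And>g. g \<in> set_pmf \<mu> \<Longrightarrow> continuous_on UNIV (\<phi> g)" and fin: "finite (set_pmf \<mu>)"
    and reg: "regular_borel_measure \<nu>" and A: "A \<in> sets borel" and e: "0 < e"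
  shows "\<exists>K. compact K \<and> K \<subseteq> A \<and>
    measure (action_conv \<phi> \<mu> \<nu>) A \<le> measure (action_conv \<phi> \<mu> \<nu>) K + e"
proof -
  interpret N: finite_measure \<nu> using reg by (simp add: regular_borel_measure_def)
  have sets: "sets \<nu> = sets borel" using reg by (simp add: regular_borel_measure_def)
  have meas: "\<phi> g \<in> borel_measurable borel" if "g \<in> set_pmf \<mu>" for g
    using borel_measurable_continuous_onI[OF cont[OF that]] .
  have vim: "\<phi> g -` B \<in> sets borel" if "g \<in> set_pmf \<mu>" "B \<in> sets borel" for g B
    using measurable_sets[OF meas[OF that(1)] that(2)] by simp
  have conv: "measure (action_conv \<phi> \<mu> \<nu>) B = (\<Sum>g\<in>set_pmf \<mu>. measure \<nu> (\<phi> g -` B) * pmf \<mu> g)"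
    if "B \<in> sets borel" for B
  proof -
    have "emeasure (action_conv \<phi> \<mu> \<nu>) B = (\<Sum>g\<in>set_pmf \<mu>. emeasure \<nu> (\<phi> g -` B) * pmf \<mu> g)"
      using meas sets that fin
      by (simp add: emeasure_action_conv nn_integral_measure_pmf_finite)
    also have "\<dots> = ennreal (\<Sum>g\<in>set_pmf \<mu>. measure \<nu> (\<phi> g -` B) * pmf \<mu> g)"
      by (simp add: N.emeasure_eq_measure ennreal_mult'' sum_nonneg flip: sum_ennreal)
    finally show ?thesis by (simp add: measure_def sum_nonneg)
  qed
  have "\<exists>K. compact K \<and> K \<subseteq> \<phi> g -` A \<and> measure \<nu> (\<phi> g -` A) \<le> measure \<nu> K + e"
    if "g \<in> set_pmf \<mu>" for g
    using regular_borel_measure_inner[OF reg vim[OF that A] e] by metis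
  then obtain k where k: "\<And>g. g \<in> set_pmf \<mu> \<Longrightarrow> compact (k g)"
      "\<And>g. g \<in> set_pmf \<mu> \<Longrightarrow> k g \<subseteq> \<phi> g -` A"
      "\<And>g. g \<in> set_pmf \<mu> \<Longrightarrow> measure \<nu> (\<phi> g -` A) \<le> measure \<nu> (k g) + e"
    by metis
  define K where "K = (\<Union>g\<in>set_pmf \<mu>. \<phi> g ` k g)"
  have "compact K"
    unfolding K_def using fin k(1) cont
    by (intro compact_UN compact_continuous_image) (auto intro: continuous_on_subset)
  moreover have "K \<subseteq> A" using k(2) by (auto simp: K_def)
  moreover have "measure (action_conv \<phi> \<mu> \<nu>) A \<le> measure (action_conv \<phi> \<mu> \<nu>) K + e"
  proof -
    have Kb: "K \<in> sets borel" using \<open>compact K\<close> by (rule borel_compact)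
    have "measure (action_conv \<phi> \<mu> \<nu>) A = (\<Sum>g\<in>set_pmf \<mu>. measure \<nu> (\<phi> g -` A) * pmf \<mu> g)"
      by (rule conv[OF A])
    also have "\<dots> \<le> (\<Sum>g\<in>set_pmf \<mu>. (measure \<nu> (\<phi> g -` K) + e) * pmf \<mu> g)"
    proof (intro sum_mono mult_right_mono)
      fix g assume g: "g \<in> set_pmf \<mu>"
      have "measure \<nu> (k g) \<le> measure \<nu> (\<phi> g -` K)"
        using g vim[OF g Kb] sets by (intro N.finite_measure_mono) (auto simp: K_def)
      with k(3)[OF g] show "measure \<nu> (\<phi> g -` A) \<le> measure \<nu> (\<phi> g -` K) + e" by simp
    qed simp
    also have "\<dots> = measure (action_conv \<phi> \<mu> \<nu>) K + e"
      using sum_pmf_eq_1[OF fin order_refl]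
      by (simp add: conv[OF Kb] distrib_right sum.distrib sum_distrib_left[symmetric])
    finally show ?thesis .
  qed
  ultimately show ?thesis by blast
qed

section \<open>Stationarity\<close>

theorem theorem2p15:
  fixes G :: "('g, 'b) monoid_scheme"
    and \<phi> :: "'g \<Rightarrow> 'x \<Rightarrow> 'x::t2_space"
    and \<mu> :: "'g pmf"
    and \<nu> :: "'x measure"
  assumes "group G" and "countable (carrier G)" and "infinite (carrier G)"
    and "compact (UNIV :: 'x set)"
    and "continuous_action G \<phi>"
    and "set_pmf \<mu> \<subseteq> carrier G"
    and "generates G (set_pmf \<mu>)"
    and "evenly_distributed G \<mu>"
    and "regular_borel_measure \<nu>"
    and "converges_to_space_average G (set_pmf \<mu>) \<phi> \<nu>"
  shows "stationary \<phi> \<mu> \<nu>"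
proof -
  interpret group G by fact
  interpret N: finite_measure \<nu> using assms(9) by (simp add: regular_borel_measure_def)
  have sets: "sets \<nu> = sets borel" using assms(9) by (simp add: regular_borel_measure_def)
  have fin: "finite (set_pmf \<mu>)"
    by (rule evenly_distributed_finite_support[OF assms(6,8)])
  have cont: "continuous_on UNIV (\<phi> g)" if "g \<in> set_pmf \<mu>" for g
    using that assms(5,6) by (auto simp: continuous_action_def)
  have meas: "\<phi> g \<in> borel_measurable borel" if "g \<in> set_pmf \<mu>" for g
    using borel_measurable_continuous_onI[OF cont[OF that]] .
  have "action_conv \<phi> \<mu> \<nu> = \<nu>"
  proof (rule regular_borel_measure_eqI[OF assms(4,9)])
    show "finite_measure (action_conv \<phi> \<mu> \<nu>)"
      by (rule finite_measureI) (simp add: emeasure_action_conv_UNIV[OF meas sets])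
    show "\<exists>K. compact K \<and> K \<subseteq> A \<and>
        measure (action_conv \<phi> \<mu> \<nu>) A \<le> measure (action_conv \<phi> \<mu> \<nu>) K + e"
      if "A \<in> sets borel" "0 < e" for A e
      by (rule action_conv_inner_regular[OF cont fin assms(9) that])
    fix f :: "'x \<Rightarrow> real" assume f: "continuous_on UNIV f"
    have fm: "f \<in> borel_measurable borel" by (rule borel_measurable_continuous_onI[OF f])
    have bdd: "bounded (range f)"
      using compact_continuous_image[OF f assms(4)] by (rule compact_imp_bounded)
    then obtain c where c: "\<And>x. \<bar>f x\<bar> \<le> c" by (auto simp: bounded_iff)
    have int: "integrable \<nu> (\<lambda>x. f (\<phi> s x))" if "s \<in> set_pmf \<mu>" for s
      using c measurable_compose[OF meas[OF that] fm]
      by (intro N.integrable_const_bound[where B = c])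
        (auto simp: measurable_cong_sets[OF sets refl])
    have "(LINT x|action_conv \<phi> \<mu> \<nu>. f x) = (LINT s|measure_pmf \<mu>. LINT x|\<nu>. f (\<phi> s x))"
      by (rule integral_action_conv[OF meas sets N.finite_measure_axioms fm bdd])
    also have "\<dots> = (LINT x|\<nu>. LINT s|measure_pmf \<mu>. f (\<phi> s x))"
      using int by (simp add: integral_measure_pmf[OF fin] Bochner_Integration.integral_sum)
    also have "\<dots> = (LINT x|\<nu>. f x)"
      by (rule integral_average_invariant[OF assms(5,4,6,7,3,8,10) f])
    finally show "(LINT x|action_conv \<phi> \<mu> \<nu>. f x) = (LINT x|\<nu>. f x)" .
  qed simp
  then show ?thesis by (simp add: stationary_def)
qed

end
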